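(* Let $u : \mathbb{R}^2 \to \mathbb{R}$ be a convex function with $\det D^2 u \leq 1$ in the Alexandrov sense. Suppose that $u(0) = 0$ and that there are a constant $c > 0$ and a neighborhood $U$ of the origin such that $$u(x_1,x_2) \geq c\,\frac{|x_2|}{|\log |x_2||} \quad \text{for all } (x_1,x_2) \in U.$$ Then $u$ vanishes on the $x_1$ axis, i.e. $u(x_1,0) = 0$ for all $x_1 \in \mathbb{R}$.
   Context: For a convex function $u$ on $\mathbb{R}^2$, the subdifferential at $x$ is $\partial u(x) = \{p \in \mathbb{R}^2 : u(y) \geq u(x) + p\cdot(y-x) \text{ for all } y\}$ and the Monge-Ampère measure is $Mu(E) = |\bigcup_{x \in E}\partial u(x)|$ for Borel sets $E$. "$\det D^2u \leq 1$ in the Alexandrov sense" means $Mu(E) \leq |E|$ for every Borel set $E \subset \mathbb{R}^2$. The expression $|x_2|/|\log|x_2||$ is understood to equal $0$ when $x_2 = 0$, and the neighborhood $U$ is taken inside $\{|x_2|<1\}$. *)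

theory Defs
  imports "HOL-Analysis.Analysis"
begin

definition subdifferential :: "('a::euclidean_space \<Rightarrow> real) \<Rightarrow> 'a \<Rightarrow> 'a set" where
  "subdifferential u x = {p. \<forall>y. u y \<ge> u x + p \<bullet> (y - x)}"

(* The completed Lebesgue measure is needed here: for convex u and Borel E the union below is
   Lebesgue measurable, but it need not be Borel, and emeasure is 0 on non-measurable sets. *)
definition monge_ampere_measure :: "('a::euclidean_space \<Rightarrow> real) \<Rightarrow> 'a set \<Rightarrow> ennreal" where
  "monge_ampere_measure u E = emeasure lebesgue (\<Union>x\<in>E. subdifferential u x)"

definition alexandrov_det_hessian_le_1 :: "('a::euclidean_space \<Rightarrow> real) \<Rightarrow> bool" where
  "alexandrov_det_hessian_le_1 u \<longleftrightarrow>
     (\<forall>E \<in> sets borel. monge_ampere_measure u E \<le> emeasure lebesgue E)"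

definition log_modulus :: "real \<Rightarrow> real" where
  "log_modulus t = (if t = 0 then 0 else \<bar>t\<bar> / \<bar>ln \<bar>t\<bar>\<bar>)"

end

theory Submission
  imports Defs
begin

text \<open>
  Suppose \<open>u \<ge> h\<close> on the line \<open>x\<^sub>1 = x\<close>. In a bounded strip the growth assumption gives
  \<open>u \<ge> q (\<bar>x\<^sub>2\<bar> - h)\<close> with \<open>q\<close> comparable to \<open>1 / \<bar>log h\<bar>\<close>. If \<open>u\<close> dropped below \<open>h / 8\<close> somewhere
  on a line at distance \<open>d\<close>, then all slopes in a rectangle of area comparable to
  \<open>(h / d) q\<close> would be attained on a rectangle of area comparable to \<open>d (h / q)\<close>,
  and \<open>det D\<^sup>2 u \<le> 1\<close> would force \<open>d\<close> to be at least of order \<open>q\<close>. So passing from the height \<open>h / 8\<^sup>n\<close>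
  to \<open>h / 8\<^sup>n\<^sup>+\<^sup>1\<close> one can move by a distance of order \<open>1 / (\<bar>log h\<bar> + n)\<close>. These distances have
  a divergent sum, so positivity of \<open>u\<close> at one point of the \<open>x\<^sub>1\<close> axis propagates
  to the whole line \<open>x\<^sub>1 = 0\<close> in finitely many steps, contradicting \<open>u 0 = 0\<close>.
\<close>

section \<open>Subdifferentials of convex functions over compact sets\<close>

lemma closed_Union_subdifferential:
  fixes u :: "'a::euclidean_space \<Rightarrow> real"
  assumes "convex_on UNIV u" "compact K"
  shows "closed (\<Union>z\<in>K. subdifferential u z)"
proof -
  have cont: "continuous_on UNIV u"
    using assms(1) by (simp add: convex_on_continuous)
  \<comment> \<open>\<open>?T\<close> is the graph of the subdifferential. It is closed because
    \<open>u\<close> is continuous, and projecting along the compact factor \<open>K\<close>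
    preserves closedness.\<close>
  let ?T = "{zp :: 'a \<times> 'a. \<forall>y. u (fst zp) + snd zp \<bullet> (y - fst zp) \<le> u y}"
  have "closed ?T"
    by (intro closed_Collect_all closed_Collect_le continuous_intros
        continuous_on_compose2[OF cont]) auto
  then have "closed {p. \<exists>z. z \<in> K \<and> (z, p) \<in> ?T}"
    by (rule closed_compact_projection[OF assms(2)])
  also have "{p. \<exists>z. z \<in> K \<and> (z, p) \<in> ?T} = (\<Union>z\<in>K. subdifferential u z)"
    by (auto simp: subdifferential_def)
  finally show ?thesis .
qed

text \<open>Subtracting the linear function of slope \<open>p\<close> leaves a convex function whose
  minimum over \<open>K\<close> cannot lie outside \<open>W\<close>. The minimiser is thus interior,
  and a local minimum of a convex function is global.\<close>

lemma mem_subdifferential_if_less_on_boundary: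
  fixes u :: "'a::euclidean_space \<Rightarrow> real"
  assumes u: "convex_on UNIV u" and "compact K" "open W" "W \<subseteq> K" "z0 \<in> K"
    and less: "\<And>z. z \<in> K - W \<Longrightarrow> u z0 < u z - p \<bullet> (z - z0)"
  shows "\<exists>z\<in>K. p \<in> subdifferential u z"
proof -
  define f where "f z = u z - p \<bullet> (z - z0)" for z
  have f: "convex_on UNIV f"
    unfolding f_def
  proof (rule convex_on_diff[OF u])
    show "concave_on UNIV (\<lambda>z. p \<bullet> (z - z0))"
      unfolding concave_on_def
      by (rule convex_onI) (auto simp: algebra_simps inner_simps)
  qed
  then have "continuous_on K f"
    using convex_on_continuous continuous_on_subset by blast
  then obtain z where z: "z \<in> K" "\<And>y. y \<in> K \<Longrightarrow> f z \<le> f y"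
    using continuous_attains_inf[of K f] \<open>compact K\<close> \<open>z0 \<in> K\<close> by blast
  have "f z \<le> f z0" using z assms by auto
  then have "z \<in> W" using less[of z] z(1) by (auto simp: f_def)
  then obtain e where "e > 0" "ball z e \<subseteq> W"
    using \<open>open W\<close> open_contains_ball by blast
  then have "\<forall>y\<in>UNIV. f z \<le> f y"
    using convex_local_global_minimum[OF _ f, of e z] z(2) \<open>W \<subseteq> K\<close> by blast
  then have "p \<in> subdifferential u z"
    by (auto simp: subdifferential_def f_def inner_simps algebra_simps)
  then show ?thesis using z(1) by blast
qed

section \<open>Areas of rectangles of points and of slopes\<close>

lemma rectangle_eq_cbox:
  fixes a b A B :: real
  shows "{z::real^2. \<bar>z$1 - a\<bar> \<le> A \<and> \<bar>z$2 - b\<bar> \<le> B}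
    = cbox (vector [a - A, b - B]) (vector [a + A, b + B])"
  by (auto simp: interval_cbox_cart[symmetric] less_eq_vec_def forall_2 abs_le_iff)

lemma emeasure_lebesgue_rectangle:
  fixes a b A B :: real
  assumes "0 \<le> A" "0 \<le> B"
  shows "emeasure lebesgue {z::real^2. \<bar>z$1 - a\<bar> \<le> A \<and> \<bar>z$2 - b\<bar> \<le> B} = ennreal (4 * A * B)"
proof -
  have ne: "cbox (vector [a - A, b - B]) (vector [a + A, b + B] :: real^2) \<noteq> {}"
    using assms by (auto simp: interval_ne_empty_cart forall_2)
  have "measure lborel (cbox (vector [a - A, b - B]) (vector [a + A, b + B] :: real^2)) = 4 * A * B"
    using ne by (subst content_cbox_cart) (auto simp: prod_2 UNIV_2)
  moreover have "emeasure lborel (cbox (vector [a - A, b - B]) (vector [a + A, b + B] :: real^2)) \<noteq> top"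
    using emeasure_lborel_cbox_finite by (metis infinity_ennreal_def less_irrefl)
  ultimately show ?thesis
    unfolding rectangle_eq_cbox
    by (simp add: emeasure_eq_ennreal_measure)
qed

lemma alexandrov_rectangle_area_le:
  fixes u :: "real^2 \<Rightarrow> real"
  assumes "convex_on UNIV u" "alexandrov_det_hessian_le_1 u"
    and "0 \<le> A" "0 \<le> B" "0 \<le> C" "0 \<le> D"
    and sub: "{p. \<bar>p$1 - c\<bar> \<le> C \<and> \<bar>p$2 - d\<bar> \<le> D} \<subseteq>
      (\<Union>z\<in>{z. \<bar>z$1 - a\<bar> \<le> A \<and> \<bar>z$2 - b\<bar> \<le> B}. subdifferential u z)"
  shows "C * D \<le> A * B"
proof -
  let ?E = "{z::real^2. \<bar>z$1 - a\<bar> \<le> A \<and> \<bar>z$2 - b\<bar> \<le> B}"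
  have E: "compact ?E" unfolding rectangle_eq_cbox by simp
  \<comment> \<open>Monotonicity of \<open>emeasure\<close> requires the larger set to be
    measurable; closedness provides this.\<close>
  have "(\<Union>z\<in>?E. subdifferential u z) \<in> sets lebesgue"
    using closed_Union_subdifferential[OF assms(1) E] borel_closed by auto
  from emeasure_mono[OF sub this]
  have "ennreal (4 * C * D) \<le> emeasure lebesgue (\<Union>z\<in>?E. subdifferential u z)"
    by (subst (asm) emeasure_lebesgue_rectangle) (use assms in auto)
  also have "\<dots> \<le> emeasure lebesgue ?E"
    using assms(2) E by (auto simp: alexandrov_det_hessian_le_1_def monge_ampere_measure_def borel_compact)
  also have "\<dots> = ennreal (4 * A * B)"
    by (rule emeasure_lebesgue_rectangle) fact+
  finally show ?thesis
    using assms by (simp add: ennreal_le_iff)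
qed

section \<open>Passing from a vertical line to a nearby one\<close>

lemma lower_bound_near_line:
  fixes u :: "real^2 \<Rightarrow> real" and x x' h q :: real
  assumes u: "convex_on UNIV u" "alexandrov_det_hessian_le_1 u"
    and nonneg: "\<And>z. 0 \<le> u z"
    and h: "0 < h" and q: "0 < q" "q \<le> 1/8" and near: "\<bar>x - x'\<bar> \<le> q / 16"
    and lower: "\<And>z. z$1 = x \<Longrightarrow> h \<le> u z"
    and growth: "\<And>z. \<bar>z$1 - x'\<bar> \<le> \<bar>x - x'\<bar> \<Longrightarrow> q * (\<bar>z$2\<bar> - h) \<le> u z"
  shows "\<And>z. z$1 = x' \<Longrightarrow> h / 8 \<le> u z"
proof (rule ccontr)
  fix z0 :: "real^2" assume z0: "z0$1 = x'" and "\<not> h / 8 \<le> u z0"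
  then have u0: "u z0 < h / 8" by simp
  define d where "d = x - x'"
  have "d \<noteq> 0" using lower[of z0] z0 u0 h by (auto simp: d_def)
  \<comment> \<open>\<open>M\<close> solves \<open>q * (M - h) = 2 * h\<close>, so growth yields
    \<open>u \<ge> 2 * h\<close> on the horizontal sides of \<open>?E\<close>.\<close>
  define M where "M = h + 2 * h / q"
  have qM: "q * M = q * h + 2 * h" using q by (simp add: M_def field_simps)
  let ?E = "{z::real^2. \<bar>z$1 - x'\<bar> \<le> \<bar>d\<bar> \<and> \<bar>z$2 - 0\<bar> \<le> M}"
  let ?W = "{z::real^2. \<bar>z$1 - x'\<bar> < \<bar>d\<bar> \<and> \<bar>z$2 - 0\<bar> < M}"
  have W: "open ?W"
    by (intro open_Collect_conj open_Collect_less continuous_intros)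
  have qy: "q * \<bar>z0$2\<bar> \<le> u z0 + q * h"
    using growth[of z0] z0 by (simp add: algebra_simps)
  have qh: "q * h \<le> h / 8" using mult_right_mono[OF q(2), of h] h by simp
  have z0E: "z0 \<in> ?E"
  proof -
    have "q * \<bar>z0$2\<bar> \<le> q * M" using qy qM u0 h by linarith
    then show ?thesis using q z0 by simp
  qed
  \<comment> \<open>The admissible slopes satisfy \<open>h / 4 \<le> p$1 * d \<le> h / 2\<close>.
    The horizontal tilt costs at most \<open>h / 2\<close> on the side \<open>z$1 = x\<close>, where
    \<open>u \<ge> h\<close>, and gains at least \<open>h / 4\<close> on the reflected side, where
    only \<open>u \<ge> 0\<close> is available.\<close>
  have touch: "\<exists>z\<in>?E. p \<in> subdifferential u z"
    if p1: "\<bar>p$1 - 3 * h / (8 * d)\<bar> \<le> h / (8 * \<bar>d\<bar>)" and p2: "\<bar>p$2 - 0\<bar> \<le> q / 8" for p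
  proof (rule mem_subdifferential_if_less_on_boundary[OF u(1) _ W _ z0E])
    show "compact ?E" unfolding rectangle_eq_cbox by simp
    show "?W \<subseteq> ?E" by auto
    have "\<bar>p$1 * d - 3 * h / 8\<bar> = \<bar>p$1 - 3 * h / (8 * d)\<bar> * \<bar>d\<bar>"
      using \<open>d \<noteq> 0\<close> by (simp flip: abs_mult add: left_diff_distrib)
    also have "\<dots> \<le> h / (8 * \<bar>d\<bar>) * \<bar>d\<bar>" by (intro mult_right_mono p1) auto
    also have "\<dots> = h / 8" using \<open>d \<noteq> 0\<close> by simp
    finally have pd: "h / 4 \<le> p$1 * d" "p$1 * d \<le> h / 2" by argo+
    fix z assume z: "z \<in> ?E - ?W"
    have qz: "q * \<bar>z$2\<bar> \<le> u z + q * h"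
      using growth[of z] z by (simp add: algebra_simps d_def)
    \<comment> \<open>Growth controls \<open>q * \<bar>z$2\<bar>\<close> by
      \<open>u z + q * h\<close>, so with \<open>\<bar>p$2\<bar> \<le> q / 8\<close> the vertical
      tilt costs only \<open>u z / 8\<close> and a small multiple of \<open>h\<close>.\<close>
    have "p$2 * (z$2 - z0$2) \<le> \<bar>p$2\<bar> * \<bar>z$2 - z0$2\<bar>" by (simp flip: abs_mult)
    also have "\<dots> \<le> q / 8 * (\<bar>z$2\<bar> + \<bar>z0$2\<bar>)" using p2 q by (intro mult_mono) auto
    also have "\<dots> \<le> (u z + u z0 + 2 * (q * h)) / 8" using qz qy by (simp add: algebra_simps)
    finally have p2z: "p$2 * (z$2 - z0$2) \<le> u z / 8 + h / 64 + h / 32" using u0 qh by argo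
    have "\<bar>p$1 * (z$1 - x')\<bar> \<le> \<bar>p$1 * d\<bar>" using z by (auto simp: abs_mult intro: mult_left_mono)
    then have p1z: "p$1 * (z$1 - x') \<le> h / 2" using pd h by linarith
    have eq: "p \<bullet> (z - z0) = p$1 * (z$1 - x') + p$2 * (z$2 - z0$2)"
      by (simp add: inner_vec_def sum_2 z0)
    from z consider "z$1 = x" | "z$1 - x' = - d" | "\<bar>z$2\<bar> = M"
      by (auto simp: d_def abs_if split: if_splits)
    then show "u z0 < u z - p \<bullet> (z - z0)"
    proof cases
      case 1
      then have "h \<le> u z" by (rule lower)
      then show ?thesis unfolding eq using p1z p2z u0 h by linarith
    next
      case 2
      then have "p$1 * (z$1 - x') \<le> - (h / 4)" using pd by simp
      then show ?thesis unfolding eq using nonneg[of z] p2z u0 h by linarith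
    next
      case 3
      then have "2 * h \<le> u z" using qz qM by simp
      then show ?thesis unfolding eq using p1z p2z u0 h by linarith
    qed
  qed
  have "h / (8 * \<bar>d\<bar>) * (q / 8) \<le> \<bar>d\<bar> * M"
    by (rule alexandrov_rectangle_area_le[OF u, where c = "3 * h / (8 * d)" and d = 0 and a = x' and b = 0])
      (use h q touch in \<open>auto simp: M_def\<close>)
  then have "h * q \<le> 64 * (\<bar>d\<bar> * \<bar>d\<bar>) * M" using \<open>d \<noteq> 0\<close> by (simp add: field_simps)
  then have "h * q * q \<le> 64 * (\<bar>d\<bar> * \<bar>d\<bar>) * (q * M)"
    using mult_right_mono[of _ _ q] q by (fastforce simp: algebra_simps)
  \<comment> \<open>Here \<open>\<bar>d\<bar> \<le> q / 16\<close> and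
    \<open>q * M \<le> 3 * h\<close> give \<open>64 * 3 / 256 = 3 / 4\<close> times
    \<open>h * q * q\<close>, which contradicts the area comparison.\<close>
  also have "\<dots> \<le> 64 * (q / 16 * (q / 16)) * (3 * h)"
  proof (rule mult_mono)
    show "64 * (\<bar>d\<bar> * \<bar>d\<bar>) \<le> 64 * (q / 16 * (q / 16))"
      using near q by (intro mult_left_mono mult_mono) (auto simp: d_def)
    show "q * M \<le> 3 * h" "0 \<le> q * M" using qM qh h mult_pos_pos[OF q(1) h] by linarith+
  qed simp
  also have "\<dots> < h * q * q" using h q by simp
  finally show False by simp
qed

section \<open>From growth near the origin to growth in a strip\<close>

lemma convex_on_scaleR_le:
  assumes "convex_on UNIV u" "u 0 = 0" "0 \<le> t" "t \<le> 1"
  shows "u (t *\<^sub>R x) \<le> t * u x"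
  using convex_onD[OF assms(1) assms(3,4), of 0 x] assms(2) by simp

text \<open>Every point scales into the ball where the hypothesis applies, and convexity with
  \<open>u 0 = 0\<close> carries the sign back along the ray.\<close>

lemma nonneg_of_log_modulus_le:
  fixes u :: "real^2 \<Rightarrow> real"
  assumes u: "convex_on UNIV u" "u 0 = 0" and "c > 0" "r > 0"
    and le: "\<And>z. norm z < r \<Longrightarrow> c * log_modulus (z$2) \<le> u z"
  shows "0 \<le> u z"
proof -
  define t where "t = min 1 (r / (2 * (norm z + 1)))"
  have np: "0 < norm z + 1" by (smt (verit) norm_ge_zero)
  have t: "0 < t" "t \<le> 1" using \<open>r > 0\<close> np by (auto simp: t_def)
  have "t * norm z \<le> r / (2 * (norm z + 1)) * norm z"
    by (intro mult_right_mono) (auto simp: t_def)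
  also have "\<dots> < r" 
  proof -
    have "r * norm z < r * (2 * (norm z + 1))" using \<open>r > 0\<close> np by (intro mult_strict_left_mono) auto
    then show ?thesis using np by (simp add: field_simps)
  qed
  finally have "c * log_modulus ((t *\<^sub>R z)$2) \<le> u (t *\<^sub>R z)" using t by (intro le) simp
  moreover have "0 \<le> c * log_modulus ((t *\<^sub>R z)$2)" using \<open>c > 0\<close> by (simp add: log_modulus_def)
  ultimately have "0 \<le> t * u z" using convex_on_scaleR_le[OF u, of t z] t by linarith
  then show ?thesis using t by (simp add: zero_le_mult_iff)
qed

text \<open>Subtracting \<open>h\<close> makes the bound trivial for
  \<open>\<bar>z$2\<bar> \<le> h\<close>. Farther out, \<open>z\<close> is scaled towards the
  origin; the logarithm there is at most twice that of \<open>h\<close>, whence the factor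
  \<open>c / 2\<close>.\<close>

lemma linear_growth_of_log_modulus_le:
  fixes u :: "real^2 \<Rightarrow> real"
  assumes u: "convex_on UNIV u" "u 0 = 0" and "c > 0" and r: "0 < r" "r \<le> 1"
    and le: "\<And>z. norm z < r \<Longrightarrow> c * log_modulus (z$2) \<le> u z"
    and h: "0 < h" "h \<le> r / (2 * (R + 2))" and R: "0 \<le> R" "\<bar>z$1\<bar> \<le> R"
  shows "c / 2 / (- ln h) * (\<bar>z$2\<bar> - h) \<le> u z"
proof -
  have "r / (2 * (R + 2)) < 1" using r R by (simp add: field_simps)
  then have h1: "h < 1" using h by linarith
  show ?thesis
  proof (cases "\<bar>z$2\<bar> \<le> h")
    case True
    have "0 \<le> u z" by (rule nonneg_of_log_modulus_le[OF u \<open>c > 0\<close> r(1) le])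
    moreover have "c / 2 / (- ln h) * (\<bar>z$2\<bar> - h) \<le> 0"
      using True h h1 \<open>c > 0\<close> by (intro mult_nonneg_nonpos) (auto simp: divide_le_0_iff)
    ultimately show ?thesis by linarith
  next
    case False
    define s where "s = \<bar>z$2\<bar>"
    have s: "h < s" using False by (simp add: s_def)
    \<comment> \<open>The factor \<open>t\<close> brings \<open>z\<close> into the ball of radius \<open>r\<close> while \<open>t s \<ge> h\<^sup>2\<close>, so that
      \<open>\<bar>ln (t s)\<bar> \<le> 2 \<bar>ln h\<bar>\<close>.\<close>
    define t where "t = r / (2 * (R + 1 + s))"
    have D: "0 < R + 1 + s" using R h s by linarith
    have t: "0 < t" "t \<le> 1" using r R h s D by (auto simp: t_def field_simps)
    have "norm z \<le> R + s"
      using norm_le_l1_cart[of z] R by (simp add: sum_2 s_def)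
    then have "t * norm z \<le> t * (R + s)" using t by simp
    also have "\<dots> < r" 
    proof -
      have "r * (R + s) < r * (2 * (R + 1 + s))" using r R D by (intro mult_strict_left_mono) auto
      then show ?thesis using D by (simp add: t_def field_simps)
    qed
    finally have "c * log_modulus (t * z$2) \<le> u (t *\<^sub>R z)" using t le[of "t *\<^sub>R z"] by simp
    also have "\<dots> \<le> t * u z" using convex_on_scaleR_le[OF u] t by simp
    finally have 1: "c * log_modulus (t * z$2) \<le> t * u z" .
    have ts1: "t * s < 1"
    proof -
      have "t * s = r * (s / (2 * (R + 1 + s)))" by (simp add: t_def)
      also have "\<dots> \<le> 1 * (s / (2 * (R + 1 + s)))" using r s h D by (intro mult_right_mono) auto
      also have "\<dots> < 1" using s h R D by (simp add: field_simps)
      finally show ?thesis .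
    qed
    have "h * h \<le> r / (2 * (R + 2)) * h" using h by (intro mult_right_mono) auto
    \<comment> \<open>This amounts to \<open>s / (R + 1 + s) \<ge> h / (R + 2)\<close>, which
      follows from \<open>s > h\<close> and \<open>h < 1\<close>.\<close>
    also have "\<dots> \<le> t * s"
    proof -
      have "r * (h * (R + 1 + s)) \<le> r * (s * (R + 2))"
      proof (intro mult_left_mono)
        have "h * (R + 1) \<le> s * (R + 1)" "h * s \<le> 1 * s"
          using s R h h1 by (auto intro!: mult_right_mono)
        then show "h * (R + 1 + s) \<le> s * (R + 2)" by (simp add: algebra_simps)
      qed (use r in auto)
      then show ?thesis using R D by (simp add: t_def field_simps)
    qed
    finally have ts: "h * h \<le> t * s" .
    have tspos: "0 < t * s" using t s h by simp
    have "ln (h * h) \<le> ln (t * s)" using ts h tspos by (subst ln_le_cancel_iff) auto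
    then have ln2: "- ln (t * s) \<le> 2 * (- ln h)" using h by (simp add: ln_mult)
    have ln0: "ln (t * s) < 0" using tspos ts1 by simp
    have "c * (t * s) / (2 * (- ln h)) \<le> c * (t * s) / (- ln (t * s))"
      using ln2 ln0 \<open>c > 0\<close> tspos h h1
      by (intro divide_left_mono mult_nonneg_nonneg[of c] mult_pos_pos[of "- ln (t * s)"]
          mult_pos_pos[of "2 * - ln h"]) auto
    also have "\<dots> = c * log_modulus (t * z$2)"
    proof -
      have "\<bar>t * z$2\<bar> = t * s" using t by (simp add: s_def abs_mult)
      then show ?thesis using tspos ln0 by (auto simp: log_modulus_def)
    qed
    also note 1
    finally have "t * (c / 2 / (- ln h) * s) \<le> t * u z" by (simp add: field_simps)
    then have "c / 2 / (- ln h) * s \<le> u z"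
      by (rule mult_left_le_imp_le) (rule t(1))
    moreover have "c / 2 / (- ln h) * (s - h) \<le> c / 2 / (- ln h) * s"
      using \<open>c > 0\<close> h h1 by (intro mult_left_mono) (auto simp: divide_le_0_iff)
    ultimately show ?thesis by (simp add: s_def)
  qed
qed

text \<open>Each term dominates a fixed multiple of the harmonic term \<open>1 / (j + 1)\<close>.
  This gives the divergence of the total distance travelled.\<close>

lemma sum_inverse_linear_unbounded:
  fixes a b C L :: real
  assumes "0 < C" "0 < a" "0 \<le> b"
  shows "\<exists>k. L \<le> (\<Sum>j<k. C / (a + real j * b))"
proof -
  let ?f = "\<lambda>j. C / (a + real j * b)"
  have nonneg: "0 \<le> ?f j" for j using assms by simp
  have "\<not> summable ?f"
  proof
    assume "summable ?f"
    then have "summable (\<lambda>j. (a + b) / C * ?f j)" by (rule summable_mult)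
    moreover have "norm (inverse (real (Suc j))) \<le> (a + b) / C * ?f j" for j
    proof -
      have "a + real j * b \<le> (a + b) * real (Suc j)" using assms by (simp add: algebra_simps)
      moreover have "0 < a + real j * b" using assms by (simp add: add_pos_nonneg)
      ultimately have "1 / real (Suc j) \<le> (a + b) / (a + real j * b)"
        by (subst frac_le_eq) (auto simp: divide_simps)
      then show ?thesis using assms by (simp add: inverse_eq_divide)
    qed
    ultimately have "summable (\<lambda>j. inverse (real (Suc j)))"
      by (rule summable_comparison_test'[where N = 0])
    then show False
      using not_summable_harmonic[where 'a = real] summable_Suc_iff[of "\<lambda>j. inverse (real j)"] by simp
  qed
  then show ?thesis
    using summableI_nonneg_bounded[of ?f L] nonneg by (meson linear)
qed

section \<open>Iteration along the horizontal axis\<close>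

theorem theorem1p4:
  fixes u :: "real^2 \<Rightarrow> real" and c :: real and U :: "(real^2) set"
  assumes "convex_on UNIV u"
    and "alexandrov_det_hessian_le_1 u"
    and "u 0 = 0"
    and "c > 0"
    and "0 \<in> interior U"
    and "U \<subseteq> {x. \<bar>x $ 2\<bar> < 1}"
    and "\<And>x. x \<in> U \<Longrightarrow> u x \<ge> c * log_modulus (x $ 2)"
  shows "\<forall>x :: real^2. x $ 2 = 0 \<longrightarrow> u x = 0"
proof (rule ccontr)
  assume "\<not> ?thesis"
  then obtain w where w: "w$2 = 0" "u w \<noteq> 0" by blast
  obtain r' where r': "r' > 0" "ball 0 r' \<subseteq> U"
    using assms(5) mem_interior by blast
  define r where "r = min r' 1"
  have r: "0 < r" "r \<le> 1" using r' by (auto simp: r_def)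
  have le: "c * log_modulus (z$2) \<le> u z" if "norm z < r" for z
    using that r' assms(7) by (auto simp: r_def)
  note nonneg = nonneg_of_log_modulus_le[OF assms(1,3,4) r(1) le]
  have "0 < u w" using nonneg[of w] w(2) by simp

  \<comment> \<open>The extra 1 leaves room for the neighbourhoods of the lines between
    \<open>w\<close> and the origin on which growth is used.\<close>
  define R where "R = \<bar>w$1\<bar> + 1"
  \<comment> \<open>The first bound is the threshold for linear growth; the second gives
    \<open>- ln h \<ge> 4 * c\<close>, that is, \<open>q h \<le> 1 / 8\<close>.\<close>
  define h0 where "h0 = min (r / (2 * (R + 2))) (exp (- 4 * c))"
  define q where "q h = c / 2 / (- ln h)" for h
  have h0: "0 < h0" using r by (simp add: h0_def R_def)
  have hlt1: "h < 1" if "h \<le> h0" for h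
    using that assms(4) by (smt (verit) h0_def min.bounded_iff one_less_exp_iff exp_less_one_iff)
  have growth: "q h * (\<bar>z$2\<bar> - h) \<le> u z" if "0 < h" "h \<le> h0" "\<bar>z$1\<bar> \<le> R" for h z
    unfolding q_def
    by (rule linear_growth_of_log_modulus_le[OF assms(1,3,4) r le, where R = R])
      (use that in \<open>auto simp: h0_def R_def\<close>)
  have q: "0 < q h" "q h \<le> 1 / 8" if "0 < h" "h \<le> h0" for h
  proof -
    have "ln h \<le> ln (exp (- 4 * c))" using that by (subst ln_le_cancel_iff) (auto simp: h0_def)
    then have "4 * c \<le> - ln h" by simp
    then show "0 < q h" "q h \<le> 1 / 8" using assms(4) by (auto simp: q_def field_simps)
  qed

  have "isCont u w"
    using convex_on_continuous[OF open_UNIV assms(1)] by (simp add: continuous_on_eq_continuous_at)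
  then obtain e where e: "e > 0" "\<And>z. dist z w < e \<Longrightarrow> dist (u z) (u w) < u w / 2"
    using \<open>0 < u w\<close> unfolding continuous_at_eps_delta by (metis half_gt_zero)
  define k where "k = min h0 (e / 4)"
  have k: "0 < k" "k \<le> h0" "k \<le> e / 4" using h0 e by (auto simp: k_def)
  \<comment> \<open>On the vertical line through \<open>w\<close>, continuity gives
    \<open>u w / 2\<close> for \<open>\<bar>z$2\<bar> \<le> 2 * k\<close>, and growth at height
    \<open>k\<close> gives \<open>q k * k\<close> beyond.\<close>
  define h where "h = min h0 (min (u w / 2) (q k * k))"
  have h: "0 < h" "h \<le> h0" using h0 \<open>0 < u w\<close> k q[of k] by (auto simp: h_def)
  have start: "h \<le> u z" if "z$1 = w$1" for z
  proof (cases "\<bar>z$2\<bar> \<le> 2 * k")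
    case True
    have "dist z w \<le> \<bar>z$2\<bar>"
      unfolding dist_norm using norm_le_l1_cart[of "z - w"] that w by (simp add: sum_2)
    then have "dist (u z) (u w) < u w / 2" using True k e by (intro e(2)) linarith
    then have "u w / 2 \<le> u z" unfolding dist_real_def by argo
    then show ?thesis by (simp add: h_def min_le_iff_disj)
  next
    case False
    have "q k * k \<le> q k * (\<bar>z$2\<bar> - k)" using False k q[of k] by (intro mult_left_mono) auto
    also have "\<dots> \<le> u z" by (rule growth) (use k that in \<open>auto simp: R_def\<close>)
    finally show ?thesis by (simp add: h_def min_le_iff_disj)
  qed

  define H where "H n = h / 8 ^ n" for n :: nat
  have H: "0 < H n" "H n \<le> h0" for n
  proof -
    show "0 < H n" using h by (simp add: H_def)
    have "h / 8 ^ n \<le> h / 1" using h by (intro divide_left_mono) auto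
    then show "H n \<le> h0" using h by (simp add: H_def)
  qed
  \<comment> \<open>\<open>q (H j) / 16\<close> is the longest step that
    \<open>lower_bound_near_line\<close> permits at height \<open>H j\<close>.\<close>
  define S where "S n = (\<Sum>j<n. q (H j) / 16)" for n
  have S0: "0 \<le> S n" for n
    unfolding S_def using q[OF H] by (intro sum_nonneg) (simp add: less_imp_le)
  have spread: "\<bar>x - w$1\<bar> \<le> S n \<Longrightarrow> \<bar>x\<bar> \<le> \<bar>w$1\<bar> \<Longrightarrow> z$1 = x \<Longrightarrow> H n \<le> u z" for n x z
  proof (induction n arbitrary: x z)
    case 0
    then show ?case using start by (simp add: S_def H_def)
  next
    case (Suc n)
    have HS: "H (Suc n) = H n / 8" by (simp add: H_def)
    have SS: "S (Suc n) = S n + q (H n) / 16" by (simp add: S_def)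
    show ?case
    proof (cases "\<bar>x - w$1\<bar> \<le> S n")
      case True
      then show ?thesis using Suc H[of n] HS by fastforce
    next
      case False
      \<comment> \<open>\<open>y\<close> is the endpoint, on the side of \<open>x\<close>, of the
        interval already reached. It lies between \<open>w$1\<close> and \<open>x\<close>, so it
        also satisfies \<open>\<bar>y\<bar> \<le> \<bar>w$1\<bar>\<close>.\<close>
      define y where "y = (if x \<le> w$1 then w$1 - S n else w$1 + S n)"
      have y: "\<bar>y - w$1\<bar> \<le> S n" "\<bar>y\<bar> \<le> \<bar>w$1\<bar>" "\<bar>y - x\<bar> \<le> q (H n) / 16"
        using False Suc.prems S0[of n] SS by (auto simp: y_def split: if_splits)
      have "H n / 8 \<le> u z"
      proof (rule lower_bound_near_line[OF assms(1,2) nonneg, where q = "q (H n)"])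
        show "z$1 = x" by fact
        show "H n \<le> u z'" if "z'$1 = y" for z' using Suc.IH y that by blast
        show "q (H n) * (\<bar>z'$2\<bar> - H n) \<le> u z'" if "\<bar>z'$1 - x\<bar> \<le> \<bar>y - x\<bar>" for z'
        proof (rule growth[OF H])
          show "\<bar>z'$1\<bar> \<le> R" using q(2)[OF H, of n] y Suc.prems that unfolding R_def by linarith
        qed
      qed (use H q[OF H] y in auto)
      then show ?thesis using HS by simp
    qed
  qed
  \<comment> \<open>Since \<open>- ln (H j) = - ln h + j * ln 8\<close>, the steps are reciprocals
    of a linear function of \<open>j\<close>, so finitely many of them reach the line through the
    origin.\<close>
  obtain n where "\<bar>w$1\<bar> \<le> (\<Sum>j<n. c / 32 / (- ln h + real j * ln 8))"
    using sum_inverse_linear_unbounded[of "c / 32" "- ln h" "ln 8"] assms(4) h hlt1 by auto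
  also have "\<dots> = S n"
    unfolding S_def q_def H_def using h
    by (intro sum.cong) (auto simp: ln_div ln_realpow)
  finally have "H n \<le> u 0" by (intro spread[of 0]) auto
  then show False using H[of n] assms(3) by simp
qed

end
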